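(* Let $\mathfrak{X}$ and $\mathfrak{Y}$ be topological spaces with carriers $X$ and $Y$, and let $\mathbf{C}$ be the class of all continuous partial functions from $\mathfrak{X}$ to $\mathfrak{Y}$. Let $\mathcal{A}$ be a finite collection of subsets of $X$. If, for each subcollection $\mathcal{K}\subseteq\mathcal{A}$, some open set of $\mathfrak{X}$ separates $\bigcup\mathcal{K}\setminus\bigcup(\mathcal{A}\setminus\mathcal{K})$ from $\bigcup(\mathcal{A}\setminus\mathcal{K})\setminus\bigcup\mathcal{K}$, then $\mathcal{A}$ is strongly join permitting for $\mathbf{C}$. Moreover, if there exists an open set of $\mathfrak{Y}$ different from $\varnothing$ and $Y$, then the converse also holds.
   Context: Functions are considered as sets of ordered pairs; $f\!\upharpoonright_A$ denotes the restriction of $f$ to $A\cap\mathrm{dom}(f)$. A partial function $f$ from $X$ to $Y$ is continuous if for every open set $V$ of $\mathfrak{Y}$, $f^{-1}(V)$ is the intersection of $\mathrm{dom}(f)$ with some open set of $\mathfrak{X}$. For a class $\mathbf{C}$ of functions, a collection $\mathcal{A}$ of sets is strongly join permitting for $\mathbf{C}$ if for every function $f$ with $\mathrm{dom}(f)\subseteq\bigcup\mathcal{A}$: if $f\!\upharpoonright_A\in\mathbf{C}$ for all $A\in\mathcal{A}$, then $f\in\mathbf{C}$. $\bigcup\mathcal{K}$ is the union of the members of $\mathcal{K}$ (empty if $\mathcal{K}=\varnothing$). A set $H$ separates $P$ from $Q$ if $H\supseteq P$ and $H\cap Q=\varnothing$. *)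

theory Defs
  imports "HOL-Analysis.Abstract_Topology"
begin

text \<open>
  A partial function is a map \<open>f :: 'a \<rightharpoonup> 'b\<close>; its restriction to \<open>A \<inter> dom f\<close> is \<open>f |` A\<close>.
  The preimage of \<open>V\<close> under \<open>f\<close> is \<open>{x. \<exists>y\<in>V. f x = Some y}\<close>.
\<close>

definition continuous_partial_maps :: "'a topology \<Rightarrow> 'b topology \<Rightarrow> ('a \<rightharpoonup> 'b) set" where
  "continuous_partial_maps X Y =
     {f. dom f \<subseteq> topspace X \<and> ran f \<subseteq> topspace Y \<and>
         (\<forall>V. openin Y V \<longrightarrow> (\<exists>U. openin X U \<and> {x. \<exists>y\<in>V. f x = Some y} = dom f \<inter> U))}"

text \<open>
  In the next definition \<open>f\<close> ranges over all partial functions between the two types, with no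
  requirement that its values lie in the carrier of a space.
\<close>

definition strongly_join_permitting :: "('a \<rightharpoonup> 'b) set \<Rightarrow> 'a set set \<Rightarrow> bool" where
  "strongly_join_permitting C \<A> \<longleftrightarrow>
     (\<forall>f. dom f \<subseteq> \<Union>\<A> \<longrightarrow> (\<forall>A\<in>\<A>. f |` A \<in> C) \<longrightarrow> f \<in> C)"

definition separates :: "'a set \<Rightarrow> 'a set \<Rightarrow> 'a set \<Rightarrow> bool" where
  "separates H P Q \<longleftrightarrow> P \<subseteq> H \<and> H \<inter> Q = {}"

end

theory Submission
  imports Defs
begin

text \<open>
  A point \<open>x\<close> of the preimage of an open set \<open>V\<close> lies exactly in the members of some \<open>\<K> \<subseteq> \<A>\<close>.
  Intersecting the finitely many open sets that witness continuity at \<open>V\<close> on the members of \<open>\<K>\<close>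
  with an open set that separates for \<open>\<K>\<close> gives a neighbourhood of \<open>x\<close> in which every point of
  the domain lies in some member of \<open>\<K>\<close>, hence is mapped into \<open>V\<close>. For the converse, map the
  two differences belonging to \<open>\<K>\<close> to a point inside and a point outside of a nontrivial
  open \<open>V\<close>: on each member of \<open>\<A>\<close> this map is constant, so it is continuous, and the preimage of \<open>V\<close>
  yields the separating open set.
\<close>

lemma continuous_partial_maps_preimage:
  assumes "f \<in> continuous_partial_maps X Y" and "openin Y V"
  obtains U where "openin X U" and "{x. \<exists>y\<in>V. f x = Some y} = dom f \<inter> U"
proof -
  have "\<exists>U. openin X U \<and> {x. \<exists>y\<in>V. f x = Some y} = dom f \<inter> U"
    using assms unfolding continuous_partial_maps_def by simp
  then show thesis using that by (elim exE conjE)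
qed

text \<open>The preimage of an open set is the whole domain or empty, according to whether it
  contains \<open>c\<close>. Inclusion in \<open>{c}\<close>, rather than equality, admits the empty
  map.\<close>

lemma constant_in_continuous_partial_maps:
  assumes "dom f \<subseteq> topspace X" and "ran f \<subseteq> {c}" and "c \<in> topspace Y"
  shows "f \<in> continuous_partial_maps X Y"
proof -
  have val: "y = c" if "f x = Some y" for x y
    using that assms(2) by (auto simp: ran_def)
  have "\<exists>U. openin X U \<and> {x. \<exists>y\<in>V. f x = Some y} = dom f \<inter> U" for V
  proof (cases "c \<in> V")
    case True
    then have "{x. \<exists>y\<in>V. f x = Some y} = dom f \<inter> topspace X"
      using val assms(1) by fastforce
    then show ?thesis by blast
  next
    case False
    then have "{x. \<exists>y\<in>V. f x = Some y} = dom f \<inter> {}"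
      using val by blast
    then show ?thesis using openin_empty by blast
  qed
  then show ?thesis
    using assms by (auto simp: continuous_partial_maps_def)
qed

lemma separated_imp_strongly_join_permitting:
  fixes X :: "'a topology" and Y :: "'b topology"
  assumes fin: "finite \<A>"
    and sep: "\<And>\<K>. \<K> \<subseteq> \<A> \<Longrightarrow> \<exists>H. openin X H \<and>
      separates H (\<Union>\<K> - \<Union>(\<A> - \<K>)) (\<Union>(\<A> - \<K>) - \<Union>\<K>)"
  shows "strongly_join_permitting (continuous_partial_maps X Y) \<A>"
  unfolding strongly_join_permitting_def
proof (intro allI impI)
  fix f :: "'a \<rightharpoonup> 'b"
  assume df: "dom f \<subseteq> \<Union>\<A>" and fA: "\<forall>A\<in>\<A>. f |` A \<in> continuous_partial_maps X Y"
  \<comment> \<open>The carrier conditions are pointwise, so each is inherited from the restriction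
    to a member of \<open>\<A>\<close> containing \<open>x\<close>.\<close>
  have pt: "x \<in> topspace X \<and> y \<in> topspace Y" if fx: "f x = Some y" for x y
  proof -
    obtain A where A: "A \<in> \<A>" "x \<in> A" using df fx by blast
    then have "(f |` A) x = Some y" using fx by simp
    then have "x \<in> dom (f |` A)" "y \<in> ran (f |` A)" by (blast intro: ranI)+
    then show ?thesis using fA A(1) unfolding continuous_partial_maps_def by blast
  qed
  have "\<exists>U. openin X U \<and> {x. \<exists>y\<in>V. f x = Some y} = dom f \<inter> U" if V: "openin Y V" for V
  proof -
    let ?P = "{x. \<exists>y\<in>V. f x = Some y}"
    \<comment> \<open>Continuity of the restriction to \<open>A\<close> controls \<open>U\<close>
      only at points of \<open>A\<close>; stating the equivalence there lets it speak of
      \<open>f\<close> itself.\<close>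
    have "\<exists>U. openin X U \<and> (\<forall>x\<in>A. x \<in> ?P \<longleftrightarrow> x \<in> dom f \<inter> U)" if A: "A \<in> \<A>" for A
    proof -
      obtain U where U: "openin X U" "{x. \<exists>y\<in>V. (f |` A) x = Some y} = dom (f |` A) \<inter> U"
        by (rule continuous_partial_maps_preimage[OF bspec[OF fA A] V])
      have "x \<in> ?P \<longleftrightarrow> x \<in> dom f \<inter> U" if "x \<in> A" for x
        using U(2) that by (simp add: set_eq_iff) (metis restrict_in)
      then show ?thesis using U(1) by blast
    qed
    then have "\<forall>A\<in>\<A>. \<exists>U. openin X U \<and> (\<forall>x\<in>A. x \<in> ?P \<longleftrightarrow> x \<in> dom f \<inter> U)"
      by (rule ballI)
    from bchoice[OF this] obtain U
      where *: "\<forall>A\<in>\<A>. openin X (U A) \<and> (\<forall>x\<in>A. x \<in> ?P \<longleftrightarrow> x \<in> dom f \<inter> U A)"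
      by (rule exE)
    have U: "openin X (U A)" if "A \<in> \<A>" for A
      using bspec[OF * that] by (rule conjunct1)
    have UP: "x \<in> ?P \<longleftrightarrow> x \<in> dom f \<inter> U A" if "A \<in> \<A>" "x \<in> A" for A x
      using bspec[OF conjunct2[OF bspec[OF * that(1)]] that(2)] .
    have nhd: "\<exists>W. openin X W \<and> x \<in> W \<and> dom f \<inter> W \<subseteq> ?P" if x: "x \<in> ?P" for x
    proof -
      \<comment> \<open>With all members through \<open>x\<close> collected, \<open>x\<close> lies
        in no member of \<open>\<A> - \<K>\<close>, so any separating \<open>H\<close> contains
        \<open>x\<close>.\<close>
      define \<K> where "\<K> = {A \<in> \<A>. x \<in> A}"
      obtain H where H: "openin X H" "separates H (\<Union>\<K> - \<Union>(\<A> - \<K>)) (\<Union>(\<A> - \<K>) - \<Union>\<K>)"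
        using sep[of \<K>] unfolding \<K>_def by blast
      have xA: "x \<in> \<Union>\<A>" using x df by blast
      then have ne: "\<K> \<noteq> {}" unfolding \<K>_def by blast
      have "finite \<K>" using fin by (simp add: \<K>_def)
      \<comment> \<open>Finiteness of \<open>\<A>\<close> enters here. Nonemptiness matters as well:
        the empty intersection is \<open>UNIV\<close>, which need not be open.\<close>
      then have "openin X (\<Inter>(U ` \<K>))"
        using ne U by (intro openin_Inter) (auto simp: \<K>_def)
      then have "openin X (H \<inter> \<Inter>(U ` \<K>))" using H(1) by blast
      moreover have "x \<in> H \<inter> \<Inter>(U ` \<K>)"
      proof
        show "x \<in> H" using H(2) xA by (auto simp: separates_def \<K>_def)
        show "x \<in> \<Inter>(U ` \<K>)" using UP x by (fastforce simp: \<K>_def)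
      qed
      moreover have "z \<in> ?P" if z: "z \<in> dom f" "z \<in> H \<inter> \<Inter>(U ` \<K>)" for z
      proof -
        have "z \<in> \<Union>\<A>" "z \<in> H" using z df by (blast dest: subsetD)+
        \<comment> \<open>Otherwise \<open>z\<close> would lie only in members outside
          \<open>\<K>\<close>, hence in the difference that \<open>H\<close> avoids.\<close>
        then have "z \<in> \<Union>\<K>" using H(2) unfolding separates_def by blast
        then obtain A where A: "A \<in> \<K>" "z \<in> A" by blast
        then have "A \<in> \<A>" by (simp add: \<K>_def)
        then show ?thesis using UP[of A z] z A by blast
      qed
      ultimately show ?thesis by blast
    qed
    \<comment> \<open>The largest open set whose trace on the domain stays inside the preimage; no
      choice of neighbourhoods is needed.\<close>
    let ?W = "\<Union>{W. openin X W \<and> dom f \<inter> W \<subseteq> ?P}"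
    have "openin X ?W" by (intro openin_Union) blast
    moreover have "?P = dom f \<inter> ?W"
    proof
      show "?P \<subseteq> dom f \<inter> ?W"
      proof
        fix x assume x: "x \<in> ?P"
        then show "x \<in> dom f \<inter> ?W" using nhd[OF x] by blast
      qed
    qed blast
    ultimately show ?thesis by blast
  qed
  then show "f \<in> continuous_partial_maps X Y"
    using pt unfolding continuous_partial_maps_def by (auto simp: ran_def)
qed

text \<open>Fits what continuity delivers: an open set known only through its trace on the domain
  \<open>P \<union> Q\<close>.\<close>

lemma separatesI: "(P \<union> Q) \<inter> H = P \<Longrightarrow> P \<inter> Q = {} \<Longrightarrow> separates H P Q"
  unfolding separates_def by blast

lemma strongly_join_permitting_imp_separated:
  fixes X :: "'a topology" and Y :: "'b topology"
  assumes sub: "\<Union>\<A> \<subseteq> topspace X"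
    and V: "openin Y V" "V \<noteq> {}" "V \<noteq> topspace Y"
    and join: "strongly_join_permitting (continuous_partial_maps X Y) \<A>"
    and \<K>: "\<K> \<subseteq> \<A>"
  shows "\<exists>H. openin X H \<and> separates H (\<Union>\<K> - \<Union>(\<A> - \<K>)) (\<Union>(\<A> - \<K>) - \<Union>\<K>)"
proof -
  let ?P = "\<Union>\<K> - \<Union>(\<A> - \<K>)" and ?Q = "\<Union>(\<A> - \<K>) - \<Union>\<K>"
  have VY: "V \<subseteq> topspace Y" using V(1) by (rule openin_subset)
  obtain v w where v: "v \<in> V" and w: "w \<in> topspace Y" "w \<notin> V"
    using V VY by blast
  \<comment> \<open>Points common to both unions are left out of the domain.\<close>
  define f where "f x = (if x \<in> ?P then Some v else if x \<in> ?Q then Some w else None)" for x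
  have df: "dom f = ?P \<union> ?Q" by (auto simp: f_def dom_def)
  then have dA: "dom f \<subseteq> \<Union>\<A>" using \<K> by blast
  have "f |` A \<in> continuous_partial_maps X Y" if A: "A \<in> \<A>" for A
  proof -
    have d: "dom (f |` A) \<subseteq> topspace X" using dA sub by auto
    \<comment> \<open>A member of \<open>\<K>\<close> misses \<open>?Q\<close> and any other member
      of \<open>\<A>\<close> misses \<open>?P\<close>, so at most one value occurs on
      \<open>A\<close>.\<close>
    have "ran (f |` A) \<subseteq> {if A \<in> \<K> then v else w}"
      using A by (auto simp: ran_def restrict_map_def f_def split: if_splits)
    then show ?thesis
      using constant_in_continuous_partial_maps[OF d] v w(1) VY by (auto split: if_splits)
  qed
  then have "f \<in> continuous_partial_maps X Y"
    using join dA unfolding strongly_join_permitting_def by blast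
  from this V(1) obtain H where H: "openin X H" "{x. \<exists>y\<in>V. f x = Some y} = dom f \<inter> H"
    by (rule continuous_partial_maps_preimage)
  have "{x. \<exists>y\<in>V. f x = Some y} = ?P"
    using v w(2) by (auto simp: f_def)
  then have "(?P \<union> ?Q) \<inter> H = ?P" using H(2) df by (simp only:)
  moreover have "?P \<inter> ?Q = {}" by blast
  ultimately have "separates H ?P ?Q" by (rule separatesI)
  then show ?thesis using H(1) by blast
qed

theorem theorem3p1:
  fixes X :: "'a topology" and Y :: "'b topology" and \<A> :: "'a set set"
  assumes "finite \<A>"
    and "\<And>A. A \<in> \<A> \<Longrightarrow> A \<subseteq> topspace X"
  shows "((\<forall>\<K>\<subseteq>\<A>. \<exists>H. openin X H \<and>
              separates H (\<Union>\<K> - \<Union>(\<A> - \<K>)) (\<Union>(\<A> - \<K>) - \<Union>\<K>))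
            \<longrightarrow> strongly_join_permitting (continuous_partial_maps X Y) \<A>)
       \<and> ((\<exists>V. openin Y V \<and> V \<noteq> {} \<and> V \<noteq> topspace Y)
            \<longrightarrow> strongly_join_permitting (continuous_partial_maps X Y) \<A>
            \<longrightarrow> (\<forall>\<K>\<subseteq>\<A>. \<exists>H. openin X H \<and>
                  separates H (\<Union>\<K> - \<Union>(\<A> - \<K>)) (\<Union>(\<A> - \<K>) - \<Union>\<K>)))"
proof (intro conjI impI allI)
  assume "\<forall>\<K>\<subseteq>\<A>. \<exists>H. openin X H \<and>
    separates H (\<Union>\<K> - \<Union>(\<A> - \<K>)) (\<Union>(\<A> - \<K>) - \<Union>\<K>)"
  then show "strongly_join_permitting (continuous_partial_maps X Y) \<A>"
    using separated_imp_strongly_join_permitting[OF assms(1), of X Y] by simp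
next
  fix \<K>
  assume "\<exists>V. openin Y V \<and> V \<noteq> {} \<and> V \<noteq> topspace Y"
    and join: "strongly_join_permitting (continuous_partial_maps X Y) \<A>"
    and \<K>: "\<K> \<subseteq> \<A>"
  then obtain V where V: "openin Y V" "V \<noteq> {}" "V \<noteq> topspace Y" by blast
  have "\<Union>\<A> \<subseteq> topspace X" using assms(2) by blast
  then show "\<exists>H. openin X H \<and> separates H (\<Union>\<K> - \<Union>(\<A> - \<K>)) (\<Union>(\<A> - \<K>) - \<Union>\<K>)"
    using V join \<K> by (rule strongly_join_permitting_imp_separated)
qed

end
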